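(* Let $X$ be an infinite dimensional Banach space and let $f,g:X\to X$ be Matkowski contractions. Assume that $f$ is compact (i.e., the closure of $f(D)$ is compact for every bounded $D\subset X$; $f$ need not be linear), and that $g$ satisfies at least one of the following conditions: (i) $g$ is affine and $\operatorname{Lip}(g)<1$; (ii) $\operatorname{Lip}(g)\le \frac12$. Then $C_{f,g}$ is nowhere dense in $X$.
   Context: A map $h:X\to X$ on a metric space $(X,d)$ is a Matkowski contraction if there is a nondecreasing function $\varphi:[0,\infty)\to\mathbb R$ with $\varphi^{(n)}(t)\to 0$ as $n\to\infty$ for every $t\ge 0$ ($\varphi^{(n)}$ is the $n$-th iterate) such that $d(h(x),h(y))\le\varphi(d(x,y))$ for all $x,y\in X$. (The inequality with $x=y$ and monotonicity force $\varphi\ge 0$, so the iterates make sense.) $\operatorname{Lip}(g)$ denotes the Lipschitz constant of $g$. A map $g$ is affine if $g=\tilde g+a$ for a linear map $\tilde g$ and some $a\in X$. For a complete metric space $X$ and a finite family $\mathcal F$ of Matkowski contractions of $X$ (an iterated function system, IFS), the attractor $A_{\mathcal F}$ is the unique nonempty compact set $A\subset X$ with $A=\bigcup_{h\in\mathcal F}h(A)$ (it exists and is unique). For a Banach space $X$, Matkowski contractions $f,g:X\to X$ and $w\in X$, put $g_w(x):=g(x)+w$ and $\mathcal F_w:=\{f,g_w\}$. Define $C_{f,g}:=\{w\in X: A_{\mathcal F_w}\text{ is connected}\}$. *)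

theory Defs
  imports "HOL-Analysis.Analysis"
begin

text \<open>The comparison function is only constrained on the half-line of nonnegative reals. It maps
  that half-line into itself, because the case of equal arguments of the contraction inequality
  gives nonnegativity at \<open>0\<close>; so the values on negative reals never enter the iterates.\<close>

definition matkowski_contraction :: "('a::metric_space \<Rightarrow> 'a) \<Rightarrow> bool" where
  "matkowski_contraction h \<longleftrightarrow>
     (\<exists>\<phi> :: real \<Rightarrow> real.
        mono_on {0..} \<phi> \<and>
        (\<forall>t\<ge>0. (\<lambda>n. (\<phi> ^^ n) t) \<longlonglongrightarrow> 0) \<and>
        (\<forall>x y. dist (h x) (h y) \<le> \<phi> (dist x y)))"

text \<open>The least Lipschitz constant, equal to \<open>\<infinity>\<close> for a map that is not Lipschitz.\<close>

definition Lip :: "('a::metric_space \<Rightarrow> 'b::metric_space) \<Rightarrow> ereal" where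
  "Lip g = Inf {ereal L | L. L-lipschitz_on UNIV g}"

definition affine_map :: "('a::real_vector \<Rightarrow> 'a) \<Rightarrow> bool" where
  "affine_map g \<longleftrightarrow> (\<exists>l a. linear l \<and> g = (\<lambda>x. l x + a))"

definition compact_map :: "('a::metric_space \<Rightarrow> 'b::metric_space) \<Rightarrow> bool" where
  "compact_map f \<longleftrightarrow> (\<forall>D. bounded D \<longrightarrow> compact (closure (f ` D)))"

definition infinite_dimensional :: "'a::real_vector set \<Rightarrow> bool" where
  "infinite_dimensional S \<longleftrightarrow> \<not> (\<exists>B. finite B \<and> S \<subseteq> span B)"

definition nowhere_dense :: "'a::topological_space set \<Rightarrow> bool" where
  "nowhere_dense S \<longleftrightarrow> interior (closure S) = {}"

definition is_attractor :: "('a::metric_space \<Rightarrow> 'a) set \<Rightarrow> 'a set \<Rightarrow> bool" where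
  "is_attractor F A \<longleftrightarrow> A \<noteq> {} \<and> compact A \<and> A = (\<Union>h\<in>F. h ` A)"

text \<open>Meaningful when \<open>F\<close> is a nonempty finite set of Matkowski contractions of a complete space:
  there is then exactly one attractor.\<close>

definition attractor :: "('a::metric_space \<Rightarrow> 'a) set \<Rightarrow> 'a set" where
  "attractor F = (THE A. is_attractor F A)"

definition connectedness_set :: "('a::banach \<Rightarrow> 'a) \<Rightarrow> ('a \<Rightarrow> 'a) \<Rightarrow> 'a set" where
  "connectedness_set f g = {w. connected (attractor {f, \<lambda>x. g x + w})}"

end

theory Submission
  imports Defs
begin

text \<open>In infinite dimension a compact set has empty interior
  (\<open>compact_imp_interior_empty\<close>), so it suffices that the part of
  \<open>connectedness_set f g\<close> inside any ball is relatively compact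
  (\<open>compact_closure_connectedness_set_Int_ball\<close>). Write g_w for the map sending x to
  g(x) + w. For all w in the given ball the attractors lie in one ball around a fixed point of
  \<open>f\<close>, and \<open>f\<close> sends that ball into one compact set K. If the attractor A
  is connected, f(A) and g_w(A) share a point k'. Unfolding A along g_w
  (\<open>subset_iterates\<close>) leaves two cases. Either k' = g_w^n(k) with k, k' in K and 1 <= n
  <= N; then w depends in a Lipschitz way on (k, k') (\<open>translate_stable\<close>), so these w
  lie in a compact set (\<open>Lipschitz_parametrized_near_compact\<close>). Or k' is in the image
  of A under g_w^(N+1), hence almost fixed by g_w, and w is close to the compact set of all k - g(k)
  with k in K. The two alternatives for \<open>g\<close> both yield a Lipschitz constant below 1 and
  \<open>translate_stable g\<close>; the latter comes from the recurrence for the difference of two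
  orbits.\<close>

section \<open>Relative compactness, and compact sets in infinite dimension\<close>

lemma compact_closure_if_near_compact:
  fixes S :: "'a::complete_space set"
  assumes "\<And>e. e > 0 \<Longrightarrow> \<exists>C. compact C \<and> (\<forall>x\<in>S. \<exists>y\<in>C. dist x y < e)"
  shows "compact (closure S)"
proof -
  have "\<exists>k. finite k \<and> closure S \<subseteq> (\<Union>x\<in>k. ball x e)" if "e > 0" for e
  proof -
    obtain C where C: "compact C" "\<forall>x\<in>S. \<exists>y\<in>C. dist x y < e/3"
      using assms[of "e/3"] \<open>e > 0\<close> by auto
    obtain k where k: "finite k" "C \<subseteq> (\<Union>x\<in>k. ball x (e/3))"
      using C(1) \<open>e > 0\<close> unfolding compact_eq_totally_bounded
      by (metis divide_pos_pos zero_less_numeral)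
    have "x \<in> (\<Union>x\<in>k. ball x e)" if x: "x \<in> closure S" for x
    proof -
      obtain s where s: "s \<in> S" "dist s x < e/3"
        using x \<open>e > 0\<close> unfolding closure_approachable
        by (metis divide_pos_pos zero_less_numeral)
      obtain y where y: "y \<in> C" "dist s y < e/3"
        using C(2) s(1) by blast
      obtain z where z: "z \<in> k" "dist z y < e/3"
        using k(2) y(1) by auto
      have "dist z x < e"
        using dist_triangle[of z x y] dist_triangle[of y x s] s(2) y(2) z(2)
        by (simp add: dist_commute)
      then show ?thesis
        using z(1) by auto
    qed
    then show ?thesis
      using k(1) by blast
  qed
  then show ?thesis
    by (simp add: compact_eq_totally_bounded complete_eq_closed)
qed

text \<open>Taking \<open>k = l\<close> in \<open>lip\<close> shows that \<open>R\<close> is a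
  partial function, Lipschitz on its domain. The domain need not be closed in \<open>K\<close>, so
  the function is extended to the closure, whose image is compact.\<close>

lemma Lipschitz_parametrized_near_compact:
  fixes S :: "'b::complete_space set" and K :: "'a::metric_space set"
  assumes "compact K"
    and par: "\<And>w. w \<in> S \<Longrightarrow> \<exists>k\<in>K. R k w"
    and lip: "\<And>k w l v. R k w \<Longrightarrow> R l v \<Longrightarrow> dist w v \<le> c * dist k l"
  shows "\<exists>C. compact C \<and> S \<subseteq> C"
proof -
  define Z where "Z = {k\<in>K. \<exists>w. R k w}"
  define \<psi> where "\<psi> k = (SOME w. R k w)" for k
  have \<psi>: "R k (\<psi> k)" if "k \<in> Z" for k
    using that unfolding Z_def \<psi>_def by (auto intro: someI)
  have "(max c 0)-lipschitz_on Z \<psi>"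
  proof (rule lipschitz_onI)
    fix k l assume "k \<in> Z" "l \<in> Z"
    then have "dist (\<psi> k) (\<psi> l) \<le> c * dist k l"
      using \<psi> lip by blast
    also have "\<dots> \<le> max c 0 * dist k l"
      by (intro mult_right_mono) auto
    finally show "dist (\<psi> k) (\<psi> l) \<le> max c 0 * dist k l" .
  qed simp
  then have "uniformly_continuous_on Z \<psi>"
    by (rule lipschitz_on_uniformly_continuous)
  then obtain \<psi>' where \<psi>': "uniformly_continuous_on (closure Z) \<psi>'" "\<And>k. k \<in> Z \<Longrightarrow> \<psi> k = \<psi>' k"
    using uniformly_continuous_on_extension_on_closure by metis
  have "closure Z \<subseteq> K"
    using assms(1) by (intro closure_minimal) (auto simp: Z_def compact_imp_closed)
  then have "compact (closure Z)"
    using assms(1) compact_Int_closed[of K "closure Z"] by (simp add: Int_absorb1)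
  then have "compact (\<psi>' ` closure Z)"
    using \<psi>'(1) by (intro compact_continuous_image uniformly_continuous_imp_continuous)
  moreover have "w \<in> \<psi>' ` closure Z" if w: "w \<in> S" for w
  proof -
    obtain k where k: "k \<in> K" "R k w"
      using par w by blast
    then have "k \<in> Z"
      by (auto simp: Z_def)
    moreover have "w = \<psi> k"
      using lip[OF k(2) \<psi>[OF \<open>k \<in> Z\<close>]] by simp
    ultimately show ?thesis
      using \<psi>'(2) closure_subset by blast
  qed
  ultimately show ?thesis
    by blast
qed

text \<open>Expanding a vector of the unit ball over a finite \<open>1/2\<close>-net gives a series whose terms are
  multiples of finitely many vectors; grouping equal vectors puts the sum into their span, and no
  closedness of finite-dimensional subspaces is needed.\<close>

lemma compact_unit_ball_imp_finite_dimensional: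
  assumes "compact (cball (0::'a::real_normed_vector) 1)"
  shows "\<not> infinite_dimensional (UNIV :: 'a set)"
proof -
  obtain F where F: "finite F" "cball (0::'a) 1 \<subseteq> (\<Union>x\<in>F. ball x (1/2))"
    using assms unfolding compact_eq_totally_bounded
    by (metis half_gt_zero_iff zero_less_one)
  define c where "c y = (SOME z. z \<in> F \<and> dist z y < 1/2)" for y :: 'a
  have c: "c y \<in> F \<and> dist (c y) y < 1/2" if "norm y \<le> 1" for y
  proof -
    have "\<exists>z. z \<in> F \<and> dist z y < 1/2"
      using F(2) that by (auto simp: subset_iff)
    then show ?thesis
      unfolding c_def by (rule someI_ex)
  qed
  have ball: "x \<in> span F" if "norm x \<le> 1" for x
  proof -
    \<comment> \<open>Rescaled remainders: \<open>c y\<close> is within 1/2 of \<open>y\<close>, so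
      doubling the error stays in the unit ball and the approximation can be repeated.\<close>
    define r where "r n = ((\<lambda>y. 2 *\<^sub>R (y - c y)) ^^ n) x" for n
    have r: "norm (r n) \<le> 1" for n
    proof (induction n)
      case (Suc n)
      then show ?case
        using c[OF Suc] by (simp add: r_def dist_norm norm_minus_commute)
    qed (use that in \<open>simp add: r_def\<close>)
    have part: "(\<Sum>n<N. (1/2)^n *\<^sub>R c (r n)) = x - (1/2)^N *\<^sub>R r N" for N
      by (induction N) (simp_all add: r_def algebra_simps)
    have "(\<lambda>N. (1/2)^N *\<^sub>R r N) \<longlonglongrightarrow> 0"
    proof (rule Lim_null_comparison)
      show "\<forall>\<^sub>F N in sequentially. norm ((1/2)^N *\<^sub>R r N) \<le> (1/2::real)^N"
        using r by (auto intro!: always_eventually mult_left_le)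
    qed (simp add: LIMSEQ_power_zero)
    then have "(\<lambda>N. x - (1/2)^N *\<^sub>R r N) \<longlonglongrightarrow> x - 0"
      by (intro tendsto_intros)
    then have s1: "(\<lambda>n. (1/2)^n *\<^sub>R c (r n)) sums x"
      by (simp add: sums_def part)
    define a where "a z n = (if c (r n) = z then (1/2)^n else 0 :: real)" for z n
    have "summable (a z)" for z
      by (rule summable_comparison_test'[of "\<lambda>n. (1/2::real)^n" 0])
        (auto simp: a_def)
    then have "(\<lambda>n. \<Sum>z\<in>F. a z n *\<^sub>R z) sums (\<Sum>z\<in>F. suminf (a z) *\<^sub>R z)"
      by (intro sums_sum sums_scaleR_left summable_sums)
    moreover have "(\<Sum>z\<in>F. a z n *\<^sub>R z) = (1/2)^n *\<^sub>R c (r n)" for n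
    proof -
      have "(\<Sum>z\<in>F. a z n *\<^sub>R z) = (\<Sum>z\<in>F. if c (r n) = z then (1/2)^n *\<^sub>R z else 0)"
        by (intro sum.cong) (auto simp: a_def)
      then show ?thesis
        using F(1) c[OF r[of n]] by simp
    qed
    ultimately have "x = (\<Sum>z\<in>F. suminf (a z) *\<^sub>R z)"
      using s1 sums_unique2 by fastforce
    then show ?thesis
      by (simp add: span_sum span_scale span_base)
  qed
  have "x \<in> span F" for x
  proof (cases "x = 0")
    case False
    have "norm x *\<^sub>R (inverse (norm x) *\<^sub>R x) \<in> span F"
      by (intro span_scale ball) (use False in simp)
    then show ?thesis
      using False by simp
  qed (simp add: span_zero)
  then show ?thesis
    unfolding infinite_dimensional_def using F(1) by blast
qed

lemma compact_imp_interior_empty: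
  fixes S :: "'a::real_normed_vector set"
  assumes "infinite_dimensional (UNIV :: 'a set)" "compact S"
  shows "interior S = {}"
proof (rule ccontr)
  assume "interior S \<noteq> {}"
  then obtain x r where r: "r > 0" "cball x r \<subseteq> S"
    by (meson ex_in_conv mem_interior_cball)
  then have "compact (cball x r)"
    using assms(2) compact_Int_closed[of S "cball x r"] by (simp add: Int_absorb1)
  then have "compact ((\<lambda>y. inverse r *\<^sub>R (y - x)) ` cball x r)"
    by (intro compact_continuous_image continuous_intros)
  moreover have "(\<lambda>y. inverse r *\<^sub>R (y - x)) ` cball x r = cball 0 1"
  proof (intro equalityI subsetI)
    fix z :: 'a assume "z \<in> cball 0 1"
    then have "x + r *\<^sub>R z \<in> cball x r" "z = inverse r *\<^sub>R (x + r *\<^sub>R z - x)"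
      using r(1) by (auto simp: dist_norm mult_left_le)
    then show "z \<in> (\<lambda>y. inverse r *\<^sub>R (y - x)) ` cball x r"
      by blast
  qed (use r(1) in \<open>auto simp: dist_norm norm_minus_commute divide_simps\<close>)
  ultimately show False
    using assms(1) compact_unit_ball_imp_finite_dimensional by metis
qed

section \<open>Matkowski contractions: strict contractivity and fixed points\<close>

text \<open>If \<open>t \<le> \<phi> t\<close>, monotonicity keeps every iterate at or above
  \<open>t\<close>, so the iterates cannot tend to 0.\<close>

lemma comparison_function_less:
  fixes \<phi> :: "real \<Rightarrow> real"
  assumes "mono_on {0..} \<phi>" "(\<lambda>n. (\<phi> ^^ n) t) \<longlonglongrightarrow> 0" "t > 0"
  shows "\<phi> t < t"
proof (rule ccontr)
  assume "\<not> \<phi> t < t"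
  have "t \<le> (\<phi> ^^ n) t" for n
  proof (induction n)
    case (Suc n)
    then have "\<phi> t \<le> \<phi> ((\<phi> ^^ n) t)"
      using assms(1,3) by (auto intro: mono_onD)
    then show ?case
      using \<open>\<not> \<phi> t < t\<close> by simp
  qed simp
  then have "t \<le> 0"
    using assms(2) by (intro LIMSEQ_le_const) auto
  then show False
    using assms(3) by simp
qed

lemma matkowski_contraction_dist_less:
  assumes "matkowski_contraction h" "x \<noteq> y"
  shows "dist (h x) (h y) < dist x y"
proof -
  obtain \<phi> where "mono_on {0..} \<phi>" "\<forall>t\<ge>0. (\<lambda>n. (\<phi> ^^ n) t) \<longlonglongrightarrow> 0"
    "\<forall>x y. dist (h x) (h y) \<le> \<phi> (dist x y)"
    using assms(1) unfolding matkowski_contraction_def by blast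
  then show ?thesis
    using comparison_function_less[of \<phi> "dist x y"] assms(2)
    by (meson dual_order.strict_trans2 not_less zero_le_dist zero_less_dist_iff)
qed

lemma matkowski_contraction_lipschitz:
  assumes "matkowski_contraction h"
  shows "1-lipschitz_on S h"
proof (rule lipschitz_onI)
  fix x y
  show "dist (h x) (h y) \<le> 1 * dist x y"
    using matkowski_contraction_dist_less[OF assms, of x y] by (cases "x = y") auto
qed simp

text \<open>Picard iteration from an arbitrary point. Step lengths tend to 0, but need not be
  summable, so the Cauchy property comes from trapping the orbit in a small ball.\<close>

lemma matkowski_fixed_point:
  fixes h :: "'a::complete_space \<Rightarrow> 'a"
  assumes "matkowski_contraction h"
  shows "\<exists>p. h p = p"
proof -
  obtain \<phi> where \<phi>: "mono_on {0..} \<phi>" "\<And>t. t \<ge> 0 \<Longrightarrow> (\<lambda>n. (\<phi> ^^ n) t) \<longlonglongrightarrow> 0"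
    "\<And>x y. dist (h x) (h y) \<le> \<phi> (dist x y)"
    using assms unfolding matkowski_contraction_def by blast
  define x where "x n = (h ^^ n) undefined" for n
  define t where "t = dist (x 0) (x 1)"
  have Suc: "x (Suc n) = h (x n)" for n
    by (simp add: x_def)
  have step: "dist (x n) (x (Suc n)) \<le> (\<phi> ^^ n) t" for n
  proof (induction n)
    case (Suc n)
    have "dist (x (Suc n)) (x (Suc (Suc n))) \<le> \<phi> (dist (x n) (x (Suc n)))"
      using \<phi>(3) by (simp only: \<open>\<And>n. x (Suc n) = h (x n)\<close>)
    also have "\<dots> \<le> \<phi> ((\<phi> ^^ n) t)"
    proof (rule mono_onD[OF \<phi>(1)])
      show "(\<phi> ^^ n) t \<in> {0..}"
        using order_trans[OF zero_le_dist Suc] by simp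
    qed (use Suc in auto)
    finally show ?case
      by simp
  qed (simp add: t_def)
  have lim: "(\<lambda>n. (\<phi> ^^ n) t) \<longlonglongrightarrow> 0"
    by (rule \<phi>(2)) (simp add: t_def)
  have "Cauchy x"
    unfolding Cauchy_altdef2
  proof (intro allI impI)
    fix e :: real assume "e > 0"
    define d where "d = e/2"
    have "d > 0"
      using \<open>e > 0\<close> by (simp add: d_def)
    then have "\<phi> d < d"
      using comparison_function_less[OF \<phi>(1) \<phi>(2)] by simp
    then have "\<forall>\<^sub>F n in sequentially. (\<phi> ^^ n) t < d - \<phi> d"
      using lim by (intro order_tendstoD(2)) auto
    then obtain n where n: "(\<phi> ^^ n) t < d - \<phi> d"
      using eventually_happens'[OF sequentially_bot] by blast
    \<comment> \<open>The ball of radius \<open>d\<close> about \<open>x n\<close> traps the orbit: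
      \<open>h\<close> brings the distance down to \<open>\<phi> d\<close>, and passing from
      \<open>x (Suc n)\<close> back to \<open>x n\<close> costs less than
      \<open>d - \<phi> d\<close>.\<close>
    have "dist (x m) (x n) \<le> d" if "m \<ge> n" for m
      using that
    proof (induction m rule: dec_induct)
      case (step m)
      have "dist (x (Suc m)) (x (Suc n)) \<le> \<phi> (dist (x m) (x n))"
        using \<phi>(3) by (simp only: Suc)
      also have "\<dots> \<le> \<phi> d"
        using step \<open>d > 0\<close> by (intro mono_onD[OF \<phi>(1)]) auto
      finally have "dist (x (Suc m)) (x n) \<le> \<phi> d + dist (x n) (x (Suc n))"
        using dist_triangle[of "x (Suc m)" "x n" "x (Suc n)"] by (simp add: dist_commute)
      then show ?case
        using n \<open>\<And>n. dist (x n) (x (Suc n)) \<le> (\<phi> ^^ n) t\<close>[of n] by linarith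
    qed (use \<open>d > 0\<close> in simp)
    then show "\<exists>N. \<forall>n\<ge>N. dist (x n) (x N) < e"
      using \<open>e > 0\<close> unfolding d_def by (smt (verit) field_sum_of_halves)
  qed
  then obtain p where p: "x \<longlonglongrightarrow> p"
    by (meson Cauchy_convergent convergentD)
  have "continuous_on UNIV h"
    using matkowski_contraction_lipschitz[OF assms] lipschitz_on_continuous_on by blast
  then have "(\<lambda>n. h (x n)) \<longlonglongrightarrow> h p"
    using p by (intro continuous_on_tendsto_compose[of UNIV h]) auto
  moreover have "(\<lambda>n. x (Suc n)) \<longlonglongrightarrow> p"
    using p by (rule LIMSEQ_Suc)
  ultimately show ?thesis
    unfolding Suc using LIMSEQ_unique by blast
qed

section \<open>Attractors: uniqueness, unfolding and existence\<close>

text \<open>A point of \<open>A\<close> at maximal distance from \<open>B\<close> is the image of a point that is no farther away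
  from \<open>B\<close>, so strict contractivity forces this distance to be \<open>0\<close>.\<close>

lemma attractor_subset:
  assumes contr: "\<And>h x y. h \<in> F \<Longrightarrow> x \<noteq> y \<Longrightarrow> dist (h x) (h y) < dist x y"
    and A: "is_attractor F A" and B: "is_attractor F B"
  shows "A \<subseteq> B"
proof -
  have AB: "A \<noteq> {}" "compact A" "A = (\<Union>h\<in>F. h ` A)" "B \<noteq> {}" "compact B" "B = (\<Union>h\<in>F. h ` B)"
    using A B unfolding is_attractor_def by auto
  have "continuous_on A (\<lambda>x. infdist x B)"
    by (intro continuous_intros)
  then obtain x where x: "x \<in> A" "\<And>y. y \<in> A \<Longrightarrow> infdist y B \<le> infdist x B"
    using continuous_attains_sup[OF AB(2,1)] by blast
  obtain h y where y: "h \<in> F" "y \<in> A" "x = h y"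
    using AB(3) x(1) by blast
  have "continuous_on B (dist y)"
    by (intro continuous_intros)
  then obtain z where z: "z \<in> B" "\<And>z'. z' \<in> B \<Longrightarrow> dist y z \<le> dist y z'"
    using continuous_attains_inf[OF AB(5,4)] by blast
  then have yz: "dist y z \<le> infdist y B"
    unfolding infdist_notempty[OF AB(4)] using AB(4) by (intro cINF_greatest) auto
  have "h z \<in> B"
    using AB(6) y(1) z(1) by blast
  then have le: "infdist x B \<le> dist (h y) (h z)"
    using y(3) infdist_le by blast
  have "y = z"
    using contr[OF y(1), of y z] le x(2)[OF y(2)] yz by fastforce
  then have "infdist x B = 0"
    using le infdist_nonneg[of x B] by simp
  then have "infdist y B = 0" if "y \<in> A" for y
    using x(2)[OF that] infdist_nonneg[of y B] by linarith
  then show ?thesis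
    using in_closed_iff_infdist_zero[OF compact_imp_closed] AB(4,5) by blast
qed

lemma attractor_eqI:
  assumes "\<And>h x y. h \<in> F \<Longrightarrow> x \<noteq> y \<Longrightarrow> dist (h x) (h y) < dist x y" "is_attractor F A"
  shows "attractor F = A"
  unfolding attractor_def
proof (rule the_equality)
  show "B = A" if "is_attractor F B" for B
    using attractor_subset[OF assms(1) that assms(2)] attractor_subset[OF assms(1,2) that] by blast
qed (rule assms(2))

lemma subset_iterates:
  assumes "A \<subseteq> f ` A \<union> g ` A"
  shows "A \<subseteq> (\<Union>n<N. (g ^^ n) ` f ` A) \<union> (g ^^ N) ` A"
proof (induction N)
  case (Suc N)
  have "(g ^^ N) ` A \<subseteq> (g ^^ N) ` (f ` A \<union> g ` A)"
    using assms by (rule image_mono)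
  also have "\<dots> = (g ^^ N) ` f ` A \<union> (g ^^ Suc N) ` A"
    by (simp only: image_Un image_comp funpow_Suc_right)
  finally have "A \<subseteq> (\<Union>n<N. (g ^^ n) ` f ` A) \<union> ((g ^^ N) ` f ` A \<union> (g ^^ Suc N) ` A)"
    using Suc by (meson Un_mono order_refl order_trans)
  then show ?case
    by (simp only: lessThan_Suc UN_insert Un_ac)
qed simp

lemma lipschitz_on_funpow:
  fixes g :: "'a::metric_space \<Rightarrow> 'a"
  assumes "L-lipschitz_on UNIV g"
  shows "(L ^ n)-lipschitz_on UNIV (g ^^ n)"
proof (induction n)
  case (Suc n)
  have "(L * L ^ n)-lipschitz_on UNIV (g \<circ> (g ^^ n))"
    using lipschitz_on_compose[OF Suc] assms lipschitz_on_subset by blast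
  then show ?case
    by simp
qed (simp add: lipschitz_on_def)

text \<open>The attractor is the largest subset \<open>A\<close> of the invariant ball with
  \<open>A \<subseteq> f ` A \<union> g ` A\<close>.\<close>

lemma attractor_exists:
  fixes f g :: "'a::complete_space \<Rightarrow> 'a"
  assumes f: "1-lipschitz_on UNIV f" "compact_map f" "f p = p"
    and g: "L-lipschitz_on UNIV g" "L < 1" "dist (g p) p \<le> (1 - L) * R"
  shows "\<exists>A. is_attractor {f, g} A \<and> A \<subseteq> cball p R"
proof -
  define D where "D = cball p R"
  define A where "A = \<Union>{S. S \<subseteq> D \<and> S \<subseteq> f ` S \<union> g ` S}"
  have L: "L \<ge> 0"
    using g(1) lipschitz_on_nonneg by blast
  have "0 \<le> (1 - L) * R"
    using g(3) zero_le_dist order_trans by blast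
  then have R: "R \<ge> 0"
    using g(2) by (simp add: zero_le_mult_iff)
  have cont: "continuous_on S f" "continuous_on S (g ^^ n)" for S n
    using f(1) lipschitz_on_funpow[OF g(1)] lipschitz_on_continuous_on continuous_on_subset by blast+
  have cont_g: "continuous_on S g" for S
    using cont(2)[of S 1] by simp
  have "f ` D \<subseteq> D"
  proof
    fix y assume "y \<in> f ` D"
    then obtain x where "y = f x" "dist p x \<le> R"
      by (auto simp: D_def)
    then show "y \<in> D"
      using lipschitz_onD[OF f(1), of p x] f(3) by (simp add: D_def)
  qed
  have "g ` D \<subseteq> D"
  proof
    fix y assume "y \<in> g ` D"
    then obtain x where x: "y = g x" "dist p x \<le> R"
      by (auto simp: D_def)
    have "dist p (g x) \<le> dist (g p) p + dist (g p) (g x)"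
      using dist_triangle[of p "g x" "g p"] by (simp add: dist_commute)
    also have "\<dots> \<le> (1 - L) * R + L * R"
      using g(3) lipschitz_onD[OF g(1), of p x] x(2) L
      by (intro add_mono) (auto intro: order_trans mult_left_mono)
    finally show "y \<in> D"
      using x(1) by (simp add: D_def algebra_simps)
  qed
  have "A \<subseteq> D"
    by (auto simp: A_def)
  have post: "A \<subseteq> f ` A \<union> g ` A"
    unfolding A_def by blast
  have greatest: "S \<subseteq> A" if "S \<subseteq> D" "S \<subseteq> f ` S \<union> g ` S" for S
    using that unfolding A_def by blast
  \<comment> \<open>The images of \<open>A\<close> together again form a set contained in its own
    images, so maximality gives the reverse inclusion.\<close>
  have inv: "f ` A \<union> g ` A \<subseteq> A"
    using post \<open>A \<subseteq> D\<close> \<open>f ` D \<subseteq> D\<close> \<open>g ` D \<subseteq> D\<close> by (intro greatest) blast+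
  have "p \<in> A"
    using greatest[of "{p}"] R f(3) by (auto simp: D_def)
  have "compact (closure A)"
  proof (rule compact_closure_if_near_compact)
    fix e :: real assume "e > 0"
    have "(\<lambda>N. L ^ N * R) \<longlonglongrightarrow> 0 * R"
      using L g(2) by (intro tendsto_intros LIMSEQ_power_zero) auto
    then obtain N where N: "L ^ N * R < e"
      using \<open>e > 0\<close> eventually_happens'[OF sequentially_bot] order_tendstoD(2)
      by (metis (mono_tags, lifting) mult_zero_left)
    \<comment> \<open>After \<open>N\<close> unfoldings the only part of \<open>A\<close> outside
      the compact pieces is its image under \<open>g ^^ N\<close>, which lies within
      \<open>L ^ N * R\<close> of the single point \<open>(g ^^ N) p\<close>.\<close>
    define C where "C = insert ((g ^^ N) p) (\<Union>n<N. (g ^^ n) ` closure (f ` D))"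
    have "compact (closure (f ` D))"
      using f(2) by (simp add: compact_map_def D_def)
    then have "compact C"
      unfolding C_def using cont(2)
      by (intro compact_insert compact_UN compact_continuous_image) auto
    moreover have "\<exists>y\<in>C. dist x y < e" if x: "x \<in> A" for x
    proof -
      consider n where "n < N" "x \<in> (g ^^ n) ` f ` A" | "x \<in> (g ^^ N) ` A"
        using subsetD[OF subset_iterates[OF post, of N] x] by blast
      then show ?thesis
      proof cases
        case 1
        have "f ` A \<subseteq> closure (f ` D)"
          using image_mono[OF \<open>A \<subseteq> D\<close>] closure_subset by (rule order_trans)
        then have "x \<in> C"
          using 1 unfolding C_def by blast
        then show ?thesis
          using \<open>e > 0\<close> by force
      next
        case 2
        then obtain a where a: "a \<in> A" "x = (g ^^ N) a"
          by blast
        have "dist x ((g ^^ N) p) \<le> L ^ N * dist a p"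
          using lipschitz_onD[OF lipschitz_on_funpow[OF g(1)]] a(2) by blast
        also have "\<dots> \<le> L ^ N * R"
          using a(1) \<open>A \<subseteq> D\<close> L by (intro mult_left_mono) (auto simp: D_def dist_commute)
        finally show ?thesis
          using N unfolding C_def by auto
      qed
    qed
    ultimately show "\<exists>C. compact C \<and> (\<forall>x\<in>A. \<exists>y\<in>C. dist x y < e)"
      by blast
  qed
  moreover from this have "compact (f ` closure A \<union> g ` closure A)"
    using cont(1) cont_g by (intro compact_Un compact_continuous_image)
  then have "closure A \<subseteq> f ` closure A \<union> g ` closure A"
    using post closure_subset[of A] by (intro closure_minimal compact_imp_closed) blast+
  \<comment> \<open>The closure also competes in the union defining \<open>A\<close>, so
    \<open>A\<close> is closed.\<close>
  then have "closure A \<subseteq> A"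
    using closure_minimal[OF \<open>A \<subseteq> D\<close>] by (intro greatest) (auto simp: D_def)
  then have "closure A = A"
    using closure_subset by blast
  ultimately show ?thesis
    using \<open>p \<in> A\<close> \<open>A \<subseteq> D\<close> post inv unfolding is_attractor_def D_def by (intro exI[of _ A]) auto
qed

lemma connected_compact_Un_meet:
  fixes S T :: "'a::t2_space set"
  assumes "connected (S \<union> T)" "compact S" "compact T" "S \<noteq> {}" "T \<noteq> {}"
  shows "S \<inter> T \<noteq> {}"
proof
  assume "S \<inter> T = {}"
  then have "S \<inter> (S \<union> T) = {} \<or> T \<inter> (S \<union> T) = {}"
    using assms(1-3) by (intro connected_closedD) (auto intro: compact_imp_closed)
  then show False
    using assms(4,5) by blast
qed

section \<open>Recovering the translation from the endpoints of an orbit\<close>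

text \<open>Stability of the solution \<open>w\<close> of \<open>g\<^sub>w\<^sup>m k = k'\<close> with respect to the data \<open>k, k'\<close>.\<close>

definition translate_stable :: "('a::real_normed_vector \<Rightarrow> 'a) \<Rightarrow> bool" where
  "translate_stable g \<longleftrightarrow> (\<forall>m. \<exists>c\<ge>0. \<forall>w v k l.
     norm (w - v) \<le> c * (norm (k - l) +
       norm (((\<lambda>x. g x + w) ^^ Suc m) k - ((\<lambda>x. g x + v) ^^ Suc m) l)))"

text \<open>With T the linear part, u = w - v and e = k - l, the orbit difference is d_n = u + T u +
  ... + T^(n-1) u + T^n e. Applying I - T collapses the sum, and since T^n shrinks u by a factor at
  most L < 1 for n >= 1, u can be solved for, with a constant independent of
  \<open>m\<close>.\<close>

lemma translate_stable_affine:
  fixes g :: "'a::real_normed_vector \<Rightarrow> 'a"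
  assumes "affine_map g" "L-lipschitz_on UNIV g" "L < 1"
  shows "translate_stable g"
  unfolding translate_stable_def
proof (intro allI exI conjI)
  obtain T a where T: "linear T" "\<And>x. g x = T x + a"
    using assms(1) unfolding affine_map_def by metis
  interpret linear T by (rule T(1))
  have L: "L \<ge> 0"
    using assms(2) lipschitz_on_nonneg by blast
  have T_le: "norm (T x) \<le> L * norm x" for x
    using lipschitz_onD[OF assms(2), of x 0] by (simp add: T(2) dist_norm zero)
  have T_le_pow: "norm ((T ^^ n) x) \<le> L ^ n * norm x" for n x
  proof (induction n)
    case (Suc n)
    have "norm (T ((T ^^ n) x)) \<le> L * (L ^ n * norm x)"
      using T_le[of "(T ^^ n) x"] mult_left_mono[OF Suc L] by linarith
    then show ?case
      by simp
  qed simp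
  show "0 \<le> 2 / (1 - L)"
    using assms(3) by simp
  fix m w v k l
  define d where "d n = ((\<lambda>x. g x + w) ^^ n) k - ((\<lambda>x. g x + v) ^^ n) l" for n
  define u e where "u = w - v" and "e = k - l"
  have d_Suc: "d (Suc n) = T (d n) + u" for n
    by (simp add: d_def u_def T(2) diff)
  have "d n - T (d n) = u - (T ^^ n) u + (T ^^ n) (e - T e)" for n
  proof (induction n)
    case (Suc n)
    have "d (Suc n) - T (d (Suc n)) = T (d n - T (d n)) + u - T u"
      by (simp add: d_Suc diff add)
    then show ?case
      by (simp add: Suc diff add)
  qed (simp add: d_def e_def)
  from this[of "Suc m"] have "u = d (Suc m) - T (d (Suc m)) + (T ^^ Suc m) u - (T ^^ Suc m) (e - T e)"
    by simp
  moreover have "norm (d (Suc m) - T (d (Suc m)) + (T ^^ Suc m) u - (T ^^ Suc m) (e - T e))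
      \<le> norm (d (Suc m)) + norm (T (d (Suc m))) + norm ((T ^^ Suc m) u) + norm ((T ^^ Suc m) (e - T e))"
    by (intro order_trans[OF norm_triangle_ineq4] order_trans[OF norm_triangle_ineq] add_mono) auto
  ultimately have "norm u \<le> norm (d (Suc m)) + norm (T (d (Suc m))) + norm ((T ^^ Suc m) u)
      + norm ((T ^^ Suc m) (e - T e))"
    by metis
  moreover have "norm (T x) \<le> norm x" for x
    using T_le[of x] mult_right_mono[of L 1 "norm x"] assms(3) by simp
  moreover have "norm ((T ^^ Suc m) x) \<le> L * norm x" for x
  proof -
    have "L ^ Suc m * norm x \<le> L ^ 1 * norm x"
      using L assms(3) by (intro mult_right_mono power_decreasing) auto
    then show ?thesis
      using T_le_pow[of "Suc m" x] by simp
  qed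
  moreover have "L * norm (e - T e) \<le> 1 * norm (e - T e)"
    using assms(3) by (intro mult_right_mono) auto
  moreover have "norm (e - T e) \<le> norm e + norm (T e)"
    by (rule norm_triangle_ineq4)
  ultimately have "norm u \<le> L * norm u + 2 * (norm e + norm (d (Suc m)))"
    by (smt (verit))
  then have "(1 - L) * norm u \<le> 2 * (norm e + norm (d (Suc m)))"
    by (simp add: algebra_simps)
  then show "norm (w - v) \<le> 2 / (1 - L) * (norm (k - l) +
       norm (((\<lambda>x. g x + w) ^^ Suc m) k - ((\<lambda>x. g x + v) ^^ Suc m) l))"
    unfolding u_def e_def d_def using assms(3) by (simp add: field_simps del: funpow.simps)
qed

text \<open>The distance a_n of the (n+1)-st orbit difference from u = w - v satisfies a_(n+1) <=
  (a_n + |u|)/2. The fixed point of this recursion is exactly |u|, which is why 1/2 is the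
  threshold: up to the contribution of e = k - l, a_n stays below |u| by 2^(-n) |u|. The resulting
  constant 2^m grows with \<open>m\<close>, which is harmless as only finitely many \<open>m\<close>
  occur for each precision.\<close>

lemma translate_stable_half:
  fixes g :: "'a::real_normed_vector \<Rightarrow> 'a"
  assumes "(1/2)-lipschitz_on UNIV g"
  shows "translate_stable g"
  unfolding translate_stable_def
proof (intro allI exI conjI)
  fix m w v k l
  define d where "d n = ((\<lambda>x. g x + w) ^^ n) k - ((\<lambda>x. g x + v) ^^ n) l" for n
  define u e where "u = w - v" and "e = k - l"
  have g_half: "norm (d (Suc n) - u) \<le> norm (d n) / 2" for n
    using lipschitz_onD[OF assms, of "((\<lambda>x. g x + w) ^^ n) k" "((\<lambda>x. g x + v) ^^ n) l"]
    by (simp add: d_def u_def dist_norm algebra_simps)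
  have "norm (d (Suc n) - u) \<le> (1 - (1/2)^n) * norm u + (1/2)^Suc n * norm e" for n
  proof (induction n)
    case 0
    show ?case
      using g_half[of 0] by (simp add: d_def e_def)
  next
    case (Suc n)
    have "norm (d (Suc (Suc n)) - u) \<le> (norm (d (Suc n) - u) + norm u) / 2"
      using g_half[of "Suc n"] norm_triangle_sub[of "d (Suc n)" u] by simp
    then show ?case
      using Suc by (simp add: algebra_simps)
  qed
  from this[of m] have "norm u \<le> norm (d (Suc m)) + (1 - (1/2)^m) * norm u + (1/2)^Suc m * norm e"
    using norm_triangle_sub[of u "d (Suc m)"] by (simp add: norm_minus_commute)
  moreover have "(1/2::real)^Suc m * norm e \<le> 1 * norm e"
    by (intro mult_right_mono power_le_one) auto
  ultimately have "(1/2)^m * norm u \<le> norm e + norm (d (Suc m))"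
    by (simp add: algebra_simps)
  then have "2^m * ((1/2)^m * norm u) \<le> 2^m * (norm e + norm (d (Suc m)))"
    by (intro mult_left_mono) auto
  then show "norm (w - v) \<le> 2^m * (norm (k - l) +
       norm (((\<lambda>x. g x + w) ^^ Suc m) k - ((\<lambda>x. g x + v) ^^ Suc m) l))"
    by (simp add: d_def u_def e_def power_one_over)
qed simp

text \<open>Every \<open>M > L\<close> is a Lipschitz constant by the definition of the infimum;
  letting \<open>M\<close> decrease to \<open>L\<close> preserves the inequality.\<close>

lemma Lip_le_lipschitz:
  assumes "Lip g \<le> ereal L"
  shows "L-lipschitz_on UNIV g"
proof -
  have *: "dist (g x) (g y) \<le> M * dist x y \<and> M \<ge> 0" if "L < M" for M x y
  proof -
    have "Lip g < ereal M"
      using assms that by (simp add: order.strict_trans1)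
    then obtain M' where "M' < M" "M'-lipschitz_on UNIV g"
      unfolding Lip_def Inf_less_iff by auto
    then show ?thesis
      using lipschitz_onD[of M' UNIV g x y] lipschitz_on_nonneg[of M' UNIV g]
        mult_right_mono[of M' M "dist x y"] by auto
  qed
  show ?thesis
  proof (rule lipschitz_onI)
    fix x y
    have "\<forall>\<^sub>F M in at_right L. dist (g x) (g y) \<le> M * dist x y"
      using * by (auto simp: eventually_at_right_less intro: eventually_mono[OF eventually_at_right_less])
    moreover have "((\<lambda>M. M * dist x y) \<longlongrightarrow> L * dist x y) (at_right L)"
      by (intro tendsto_intros)
    ultimately show "dist (g x) (g y) \<le> L * dist x y"
      by (intro tendsto_lowerbound) auto
    show "L \<ge> 0"
      using * by (meson dense_ge)
  qed
qed

section \<open>Relative compactness of bounded parts of the connectedness set\<close>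

text \<open>If \<open>A\<^sub>w\<close> is connected, then \<open>f ` A\<^sub>w\<close> meets \<open>g\<^sub>w ` A\<^sub>w\<close> in a point \<open>k'\<close>. Either
  \<open>k' = g\<^sub>w\<^sup>n k\<close> for some \<open>k \<in> f ` A\<^sub>w\<close> and some small \<open>n \<ge> 1\<close>, or \<open>k'\<close> is almost fixed by
  \<open>g\<^sub>w\<close>, in which case \<open>w\<close> is close to \<open>k' - g k'\<close>.\<close>

lemma compact_closure_connectedness_set_Int_ball:
  fixes f g :: "'a::banach \<Rightarrow> 'a"
  assumes f: "matkowski_contraction f" "compact_map f"
    and g: "L-lipschitz_on UNIV g" "L < 1" "translate_stable g"
  shows "compact (closure (connectedness_set f g \<inter> ball w0 r))"
proof (rule compact_closure_if_near_compact)
  fix e :: real assume "e > 0"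
  define gw where "gw w x = g x + w" for w x
  have L: "L \<ge> 0"
    using g(1) lipschitz_on_nonneg by blast
  obtain p where p: "f p = p"
    using matkowski_fixed_point[OF f(1)] by blast
  \<comment> \<open>Chosen so that \<open>(1 - L) * R\<close> bounds the displacement of
    \<open>p\<close> under \<open>gw w\<close> for every \<open>w\<close> in the ball, as
    \<open>attractor_exists\<close> requires.\<close>
  define R where "R = (norm (g p + w0 - p) + \<bar>r\<bar>) / (1 - L)"
  define K where "K = closure (f ` cball p R)"
  have K: "compact K"
    using f(2) by (simp add: K_def compact_map_def)
  have gw_lip: "L-lipschitz_on UNIV (gw w)" for w
    using g(1) by (simp add: gw_def lipschitz_on_def)
  have "(\<lambda>N. L ^ Suc N * (2 * R)) \<longlonglongrightarrow> 0 * (2 * R)"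
    using L g(2) by (intro tendsto_intros LIMSEQ_Suc[OF LIMSEQ_power_zero]) auto
  then obtain N where N: "L ^ Suc N * (2 * R) < e"
    using \<open>e > 0\<close> eventually_happens'[OF sequentially_bot] order_tendstoD(2)
    by (metis (mono_tags, lifting) mult_zero_left)
  \<comment> \<open>Parameters with an exact chain of \<open>Suc n\<close> steps from
    \<open>K\<close> to \<open>K\<close>. At least one step is taken, since the zeroth iterate
    carries no information on \<open>w\<close>.\<close>
  define M where "M n = {w. \<exists>k\<in>K. \<exists>k'\<in>K. (gw w ^^ Suc n) k = k'}" for n
  have "\<exists>C. compact C \<and> M n \<subseteq> C" for n
  proof -
    obtain c where c: "c \<ge> 0" "\<And>w v k l. norm (w - v) \<le> c * (norm (k - l) +
       norm ((gw w ^^ Suc n) k - (gw v ^^ Suc n) l))"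
      using g(3) unfolding translate_stable_def gw_def by metis
    show ?thesis
    proof (rule Lipschitz_parametrized_near_compact[of "K \<times> K" _
          "\<lambda>s w. (gw w ^^ Suc n) (fst s) = snd s" "2 * c"])
      show "compact (K \<times> K)"
        using K by (intro compact_Times)
      show "\<exists>s\<in>K \<times> K. (gw w ^^ Suc n) (fst s) = snd s" if "w \<in> M n" for w
        using that by (auto simp: M_def)
      fix s w t v
      assume "(gw w ^^ Suc n) (fst s) = snd s" "(gw v ^^ Suc n) (fst t) = snd t"
      then have "dist w v \<le> c * (dist (fst s) (fst t) + dist (snd s) (snd t))"
        using c(2)[of w v "fst s" "fst t"] by (simp only: dist_norm)
      also have "\<dots> \<le> c * (dist s t + dist s t)"
        using c(1) by (intro mult_left_mono add_mono dist_fst_le dist_snd_le)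
      finally show "dist w v \<le> 2 * c * dist s t"
        by simp
    qed
  qed
  then obtain Q where Q: "\<And>n. compact (Q n)" "\<And>n. M n \<subseteq> Q n"
    by metis
  define C where "C = (\<lambda>k. k - g k) ` K \<union> (\<Union>n<N. Q n)"
  have "continuous_on K g"
    using g(1) lipschitz_on_continuous_on continuous_on_subset by blast
  then have "compact C"
    unfolding C_def using K Q(1)
    by (intro compact_Un compact_UN compact_continuous_image continuous_intros) auto
  moreover have "\<exists>y\<in>C. dist w y < e" if w: "w \<in> connectedness_set f g \<inter> ball w0 r" for w
  proof -
    have "norm (g p + w - p) \<le> norm (g p + w0 - p) + norm (w - w0)"
      using norm_triangle_ineq[of "g p + w0 - p" "w - w0"] by (simp add: algebra_simps)
    also have "\<dots> \<le> norm (g p + w0 - p) + \<bar>r\<bar>"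
      using w by (auto simp: dist_norm norm_minus_commute)
    also have "\<dots> = (1 - L) * R"
      using g(2) by (simp add: R_def)
    finally have "dist (gw w p) p \<le> (1 - L) * R"
      by (simp add: gw_def dist_norm)
    then obtain A where A: "is_attractor {f, gw w} A" "A \<subseteq> cball p R"
      using attractor_exists[OF matkowski_contraction_lipschitz[OF f(1)] f(2) p gw_lip g(2)] by blast
    have "dist (gw w x) (gw w y) < dist x y" if "x \<noteq> y" for x y
    proof -
      have "L * dist x y < 1 * dist x y"
        using that g(2) by (intro mult_strict_right_mono) auto
      then show ?thesis
        using lipschitz_onD[OF gw_lip, of x y w] by simp
    qed
    then have "attractor {f, gw w} = A"
      using A(1) matkowski_contraction_dist_less[OF f(1)] by (intro attractor_eqI) auto
    then have "connected A"
      using w by (simp add: connectedness_set_def gw_def[abs_def])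
    have A': "A \<noteq> {}" "compact A" "A = f ` A \<union> gw w ` A"
      using A(1) by (auto simp: is_attractor_def)
    have "continuous_on A f" "continuous_on A (gw w)"
      using matkowski_contraction_lipschitz[OF f(1)] gw_lip lipschitz_on_continuous_on
        continuous_on_subset by blast+
    then have "f ` A \<inter> gw w ` A \<noteq> {}"
      using A' \<open>connected A\<close> by (intro connected_compact_Un_meet compact_continuous_image) auto
    then obtain k' b where b: "b \<in> A" "k' = gw w b" "k' \<in> f ` A"
      by blast
    have "f ` A \<subseteq> K"
      unfolding K_def using image_mono[OF A(2)] closure_subset by (rule order_trans)
    consider n k where "n < N" "k \<in> f ` A" "b = (gw w ^^ n) k" | a where "a \<in> A" "b = (gw w ^^ N) a"
      using subsetD[OF subset_iterates[OF equalityD1[OF A'(3)], of N] b(1)] by blast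
    then show ?thesis
    proof cases
      case 1
      then have "w \<in> M n"
        using b \<open>f ` A \<subseteq> K\<close> by (auto simp: M_def)
      then show ?thesis
        using 1(1) Q(2) \<open>e > 0\<close> unfolding C_def by force
    next
      case 2
      then have k': "k' = (gw w ^^ Suc N) a"
        using b by simp
      have "gw w a \<in> A"
        using 2(1) A'(3) by blast
      \<comment> \<open>Both points are images under the same \<open>Suc N\<close>-fold iterate, of
        \<open>gw w a\<close> and \<open>a\<close>, which lie in a ball of radius \<open>R\<close>.
        The displacement of \<open>k'\<close> is the norm of \<open>w - (k' - g k')\<close>.\<close>
      have "dist (gw w k') k' = dist ((gw w ^^ Suc N) (gw w a)) ((gw w ^^ Suc N) a)"
        by (simp add: k' funpow_swap1)
      also have "\<dots> \<le> L ^ Suc N * dist (gw w a) a"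
        using lipschitz_onD[OF lipschitz_on_funpow[OF gw_lip]] by blast
      also have "\<dots> \<le> L ^ Suc N * (2 * R)"
      proof (intro mult_left_mono)
        show "dist (gw w a) a \<le> 2 * R"
          using subsetD[OF A(2) \<open>gw w a \<in> A\<close>] subsetD[OF A(2) 2(1)] dist_triangle[of "gw w a" a p]
          by (simp add: dist_commute)
      qed (use L in simp)
      finally have "dist w (k' - g k') < e"
        using N by (simp add: gw_def dist_norm algebra_simps)
      then show ?thesis
        using b(3) \<open>f ` A \<subseteq> K\<close> unfolding C_def by blast
    qed
  qed
  ultimately show "\<exists>C. compact C \<and> (\<forall>x\<in>connectedness_set f g \<inter> ball w0 r. \<exists>y\<in>C. dist x y < e)"
    by blast
qed

theorem corollary2p4:
  fixes f g :: "'a::banach \<Rightarrow> 'a"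
  assumes "infinite_dimensional (UNIV :: 'a set)"
    and "matkowski_contraction f"
    and "matkowski_contraction g"
    and "compact_map f"
    and "(affine_map g \<and> Lip g < 1) \<or> Lip g \<le> ereal (1 / 2)"
  shows "nowhere_dense (connectedness_set f g)"
proof -
  have "\<exists>L<1. L-lipschitz_on UNIV g \<and> translate_stable g"
    using assms(5)
  proof
    assume *: "affine_map g \<and> Lip g < 1"
    then obtain L where "L < 1" "L-lipschitz_on UNIV g"
      unfolding Lip_def Inf_less_iff by auto
    then show ?thesis
      using * translate_stable_affine by blast
  next
    assume "Lip g \<le> ereal (1 / 2)"
    then show ?thesis
      using translate_stable_half Lip_le_lipschitz by (intro exI[of _ "1/2"]) auto
  qed
  then obtain L where L: "L-lipschitz_on UNIV g" "L < 1" "translate_stable g"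
    by blast
  have "w \<notin> interior (closure (connectedness_set f g))" for w
  proof
    assume "w \<in> interior (closure (connectedness_set f g))"
    then obtain r where r: "r > 0" "ball w r \<subseteq> closure (connectedness_set f g)"
      by (meson mem_interior)
    \<comment> \<open>Because the ball is open, points of the set inside the ball are already dense
      in it; the closure of this bounded part is compact and yet contains a ball.\<close>
    have "ball w r \<subseteq> closure (connectedness_set f g \<inter> ball w r)"
      using open_Int_closure_subset[of "ball w r" "connectedness_set f g"] r(2)
      by (simp add: Int_absorb2 Int_commute)
    then have "ball w r \<subseteq> interior (closure (connectedness_set f g \<inter> ball w r))"
      by (simp add: interior_maximal)
    then show False
      using compact_imp_interior_empty[OF assms(1)
          compact_closure_connectedness_set_Int_ball[OF assms(2,4) L, of w r]] r(1)
      by (metis centre_in_ball empty_iff subset_iff)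
  qed
  then show ?thesis
    unfolding nowhere_dense_def by blast
qed

end
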